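(* Let $X$ be a discrete random variable (finitely or countably infinitely valued) and let $Y$ be a random variable jointly distributed with $X$. If $\alpha\in(0,1)\cup(1,\infty)$, then $$\frac{\alpha}{1-\alpha}\log g_\alpha(\varepsilon_{X|Y})\le H_\alpha(X|Y),$$ where the piecewise linear function $g_\alpha\colon[0,1)\to\mathcal{D}_\alpha$, with $\mathcal{D}_\alpha=[1,\infty)$ for $\alpha\in(0,1)$ and $\mathcal{D}_\alpha=(0,1]$ for $\alpha\in(1,\infty)$, is defined by $$g_\alpha(t)=\Bigl(k(k+1)^{\frac1\alpha}-k^{\frac1\alpha}(k+1)\Bigr)t+k^{\frac1\alpha+1}-(k-1)(k+1)^{\frac1\alpha}$$ on the interval $t\in\bigl[1-\frac1k,1-\frac1{k+1}\bigr)$, for every positive integer $k$.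
   Context: Logarithms have an arbitrary fixed base larger than 1. $X$ takes values in a discrete set $\mathcal{X}$ and $Y$ in an arbitrary observation space $\mathcal{Y}$. The Arimoto-R\'enyi conditional entropy of order $\alpha\in(0,1)\cup(1,\infty)$ is $$H_\alpha(X|Y)=\frac{\alpha}{1-\alpha}\log\mathbb{E}\left[\Bigl(\sum_{x\in\mathcal{X}}P_{X|Y}^\alpha(x|Y)\Bigr)^{1/\alpha}\right]$$ (possibly $+\infty$), the expectation being over $Y\sim P_Y$. The minimum error probability of guessing $X$ from $Y$ is $\varepsilon_{X|Y}=\min_{\mathcal{L}\colon\mathcal{Y}\to\mathcal{X}}\mathbb{P}[X\ne\mathcal{L}(Y)]=1-\mathbb{E}[\max_{x\in\mathcal{X}}P_{X|Y}(x|Y)]$. *)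

theory Defs
  imports "HOL-Probability.Probability"
begin

section \<open>Powers and logarithms on \<open>[0, \<infinity>]\<close>\<close>

text \<open>Only used with exponents \<open>r > 0\<close>, hence \<open>\<infinity>\<close> is mapped to \<open>\<infinity>\<close> and \<open>0\<close> to \<open>0\<close>.\<close>

definition ennreal_powr :: "ennreal \<Rightarrow> real \<Rightarrow> ennreal" where
  "ennreal_powr x r = (if x = \<infinity> then \<infinity> else ennreal (enn2real x powr r))"

definition log_ennreal :: "real \<Rightarrow> ennreal \<Rightarrow> ereal" where
  "log_ennreal b x =
     (if x = 0 then -\<infinity> else if x = \<infinity> then \<infinity> else ereal (log b (enn2real x)))"

section \<open>Conditional probabilities and Arimoto--R\'enyi conditional entropy\<close>

text \<open>
  The random variable \<open>\<omega> \<mapsto> P(X = x | Y) (\<omega>)\<close>, i.e. the conditional expectation of the indicator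
  of \<open>X = x\<close> given the \<open>\<sigma>\<close>-algebra generated by \<open>Y\<close>. It is determined up to null sets, and it lies
  in \<open>[0, 1]\<close> almost surely.
\<close>

definition cond_pmf ::
  "'w measure \<Rightarrow> 'y measure \<Rightarrow> ('w \<Rightarrow> 'x) \<Rightarrow> ('w \<Rightarrow> 'y) \<Rightarrow> 'x \<Rightarrow> 'w \<Rightarrow> real" where
  "cond_pmf M N X Y x =
     real_cond_exp M (vimage_algebra (space M) Y N) (indicator (X -` {x} \<inter> space M))"

text \<open>
  The sum over the alphabet and the expectation may be \<open>\<infinity>\<close> if \<open>\<alpha> < 1\<close>; both are therefore
  taken in \<open>[0, \<infinity>]\<close>, and the entropy is an extended real.
\<close>

definition arimoto_renyi_entropy ::
  "real \<Rightarrow> real \<Rightarrow> 'w measure \<Rightarrow> 'x set \<Rightarrow> 'y measure \<Rightarrow> ('w \<Rightarrow> 'x) \<Rightarrow> ('w \<Rightarrow> 'y) \<Rightarrow> ereal" where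
  "arimoto_renyi_entropy b \<alpha> M A N X Y =
     ereal (\<alpha> / (1 - \<alpha>)) *
     log_ennreal b
       (\<integral>\<^sup>+ \<omega>. ennreal_powr (\<Sum>\<^sub>\<infinity>x\<in>A. ennreal (cond_pmf M N X Y x \<omega> powr \<alpha>)) (1 / \<alpha>) \<partial>M)"

section \<open>Minimum error probability\<close>

text \<open>
  The estimators are the measurable maps from the observation space into the alphabet \<open>A\<close>. The
  infimum is a minimum, attained by a maximum a posteriori estimator.
\<close>

definition min_error_prob ::
  "'w measure \<Rightarrow> 'x set \<Rightarrow> 'y measure \<Rightarrow> ('w \<Rightarrow> 'x) \<Rightarrow> ('w \<Rightarrow> 'y) \<Rightarrow> real" where
  "min_error_prob M A N X Y =
     (INF L \<in> N \<rightarrow>\<^sub>M count_space A. \<P>(\<omega> in M. X \<omega> \<noteq> L (Y \<omega>)))"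

lemma min_error_prob_range:
  assumes "prob_space M" "countable A" "X \<in> M \<rightarrow>\<^sub>M count_space A" "Y \<in> M \<rightarrow>\<^sub>M N"
  shows "min_error_prob M A N X Y \<in> {0..<1}"
proof -
  interpret prob_space M by fact
  let ?e = "\<lambda>L. \<P>(\<omega> in M. X \<omega> \<noteq> L (Y \<omega>))"
  have meas: "{\<omega> \<in> space M. X \<omega> = x} \<in> sets M" if "x \<in> A" for x
  proof -
    have "{\<omega> \<in> space M. X \<omega> = x} = X -` {x} \<inter> space M" by auto
    then show ?thesis using measurable_sets[OF assms(3), of "{x}"] that by simp
  qed
  have "\<exists>x\<in>A. \<P>(\<omega> in M. X \<omega> = x) \<noteq> 0"
  proof (rule ccontr)
    assume *: "\<not> ?thesis"
    have "AE \<omega> in M. X \<omega> \<noteq> x" if "x \<in> A" for x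
    proof -
      have "AE \<omega> in M. \<omega> \<notin> {\<omega> \<in> space M. X \<omega> = x}"
        using prob_eq_0[OF meas[OF that]] * that by blast
      then show ?thesis using AE_space by eventually_elim auto
    qed
    then have "AE \<omega> in M. \<forall>x\<in>A. X \<omega> \<noteq> x"
      by (subst AE_ball_countable[OF assms(2)]) blast
    moreover have "AE \<omega> in M. X \<omega> \<in> A"
      using measurable_space[OF assms(3)] by auto
    ultimately have "AE \<omega> in M. False" by eventually_elim auto
    then show False by simp
  qed
  then obtain x where x: "x \<in> A" "\<P>(\<omega> in M. X \<omega> = x) \<noteq> 0" by blast
  have L: "(\<lambda>_. x) \<in> N \<rightarrow>\<^sub>M count_space A" using x by auto
  have "\<P>(\<omega> in M. X \<omega> \<noteq> x) = 1 - \<P>(\<omega> in M. X \<omega> = x)"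
    using prob_neg[OF meas[OF x(1)]] by simp
  moreover have "\<P>(\<omega> in M. X \<omega> = x) \<ge> 0" by simp
  ultimately have "?e (\<lambda>_. x) < 1" using x(2) by linarith
  moreover have "min_error_prob M A N X Y \<le> ?e (\<lambda>_. x)"
    unfolding min_error_prob_def by (rule cINF_lower[OF _ L]) (auto intro!: bdd_belowI2[of _ 0])
  moreover have "min_error_prob M A N X Y \<ge> 0"
    unfolding min_error_prob_def using L by (intro cINF_greatest) auto
  ultimately show ?thesis by simp
qed

section \<open>The piecewise linear function\<close>

definition g_fun :: "real \<Rightarrow> real \<Rightarrow> real" where
  "g_fun \<alpha> t =
     (let k = real (THE k. k > 0 \<and> t \<in> {1 - 1 / real k ..< 1 - 1 / (real k + 1)})
      in (k * (k + 1) powr (1 / \<alpha>) - k powr (1 / \<alpha>) * (k + 1)) * t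
           + k powr (1 / \<alpha> + 1) - (k - 1) * (k + 1) powr (1 / \<alpha>))"

definition D_set :: "real \<Rightarrow> real set" where
  "D_set \<alpha> = (if \<alpha> < 1 then {1..} else {0<..1})"

lemma piece_unique:
  assumes "k > 0" "t \<in> {1 - 1 / real k ..< 1 - 1 / (real k + 1)}"
    and "m > 0" "t \<in> {1 - 1 / real m ..< 1 - 1 / (real m + 1)}"
  shows "m = k"
proof -
  have aux: "p \<le> q" if "0 < p" "0 < q" "t \<ge> 1 - 1 / real p" "t < 1 - 1 / (real q + 1)" for p q :: nat
  proof -
    have "1 / (real q + 1) < 1 / real p" using that by linarith
    then have "real p < real q + 1" using that by (simp add: divide_simps)
    then show ?thesis by linarith
  qed
  show ?thesis by (rule antisym; rule aux) (use assms in \<open>simp_all only: atLeastLessThan_iff\<close>)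
qed

lemma g_fun_eq:
  fixes k :: nat
  assumes "k > 0" "t \<in> {1 - 1 / real k ..< 1 - 1 / (real k + 1)}"
  shows "g_fun \<alpha> t =
      (real k * (real k + 1) powr (1 / \<alpha>) - real k powr (1 / \<alpha>) * (real k + 1)) * t
        + real k powr (1 / \<alpha> + 1) - (real k - 1) * (real k + 1) powr (1 / \<alpha>)"
proof -
  have "(THE k. k > 0 \<and> t \<in> {1 - 1 / real k ..< 1 - 1 / (real k + 1)}) = k"
    by (rule the_equality) (use assms piece_unique[OF assms] in blast)+
  then show ?thesis unfolding g_fun_def Let_def by simp
qed

lemma piece_exists:
  assumes "t \<in> {0..<1::real}"
  obtains k :: nat where "k > 0" "t \<in> {1 - 1 / real k ..< 1 - 1 / (real k + 1)}"
proof -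
  define k where "k = nat \<lfloor>1 / (1 - t)\<rfloor>"
  have "1 / (1 - t) \<ge> 1" using assms by (simp add: divide_simps)
  then have "\<lfloor>1 / (1 - t)\<rfloor> \<ge> 1" by simp
  then have k: "k > 0" "real k \<le> 1 / (1 - t)" "1 / (1 - t) < real k + 1"
    unfolding k_def by (auto, linarith+)
  have t: "1 - t > 0" using assms by simp
  have "real k * (1 - t) \<le> 1" using k(2) t by (simp add: field_simps)
  then have "1 - 1 / real k \<le> t" using k(1) by (simp add: field_simps)
  moreover have "1 < (real k + 1) * (1 - t)" using k(3) t by (simp add: field_simps)
  then have "t < 1 - 1 / (real k + 1)" using k(1) by (simp add: field_simps)
  ultimately show ?thesis using that k(1) by auto
qed

lemma g_fun_range:
  assumes "\<alpha> > 0" "\<alpha> \<noteq> 1"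
  shows "g_fun \<alpha> \<in> {0..<1} \<rightarrow> D_set \<alpha>"
proof
  fix t :: real assume "t \<in> {0..<1}"
  then obtain k :: nat where k: "k > 0" "t \<in> {1 - 1 / real k ..< 1 - 1 / (real k + 1)}"
    by (rule piece_exists)
  define r where "r = real k"
  have r: "r \<ge> 1" "1 - 1 / r \<le> t" "t < 1 - 1 / (r + 1)" using k unfolding r_def by auto
  define a where "a = r powr (1 / \<alpha> - 1)"
  define c where "c = (r + 1) powr (1 / \<alpha> - 1)"
  define s where "s = r * (r + 1) * t - (r - 1) * (r + 1)"
  have pw: "x powr (1 / \<alpha>) = x * x powr (1 / \<alpha> - 1)"
    "x powr (1 / \<alpha> + 1) = x * (x * x powr (1 / \<alpha> - 1))" if "x \<ge> 1" for x :: real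
  proof -
    show 1: "x powr (1 / \<alpha>) = x * x powr (1 / \<alpha> - 1)" using that by (simp add: powr_diff)
    show "x powr (1 / \<alpha> + 1) = x * (x * x powr (1 / \<alpha> - 1))"
      using that by (simp add: powr_add powr_diff)
  qed
  have r1: "r + 1 \<ge> 1" using r by simp
  have "g_fun \<alpha> t = (r * ((r + 1) * c) - r * a * (r + 1)) * t + r * (r * a) - (r - 1) * ((r + 1) * c)"
    using g_fun_eq[OF k, of \<alpha>] pw[OF r(1)] pw(1)[OF r1] by (simp only: r_def a_def c_def)
  also have "\<dots> = c * s + a * (1 - s)"
    unfolding s_def by algebra
  finally have g: "g_fun \<alpha> t = c * s + a * (1 - s)" .
  have "r - 1 \<le> r * t" using r by (simp add: field_simps)
  then have "(r - 1) * (r + 1) \<le> (r * t) * (r + 1)" using r by (intro mult_right_mono) auto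
  then have s0: "s \<ge> 0" unfolding s_def by (simp add: algebra_simps)
  have "(r + 1) * t < r" using r by (simp add: field_simps)
  then have "r * ((r + 1) * t) < r * r" using r by (intro mult_strict_left_mono) auto
  then have s1: "s < 1" unfolding s_def by (simp add: algebra_simps)
  have pos: "a > 0" "c > 0" using r unfolding a_def c_def by auto
  show "g_fun \<alpha> t \<in> D_set \<alpha>"
  proof (cases "\<alpha> < 1")
    case True
    then have "1 / \<alpha> - 1 \<ge> 0" using assms by (simp add: field_simps)
    then have "a \<ge> 1" "c \<ge> 1" using r unfolding a_def c_def by (auto intro: ge_one_powr_ge_zero)
    then have "1 * s + 1 * (1 - s) \<le> c * s + a * (1 - s)"
      using s0 s1 by (intro add_mono mult_right_mono) auto
    then show ?thesis using True g by (simp add: D_set_def)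
  next
    case False
    then have e: "1 / \<alpha> - 1 \<le> 0" using assms by (simp add: field_simps)
    have "a \<le> 1" "c \<le> 1"
      unfolding a_def c_def using powr_mono[OF e, of r] powr_mono[OF e, of "r + 1"] r by auto
    then have "c * s + a * (1 - s) \<le> 1 * s + 1 * (1 - s)"
      using s0 s1 by (intro add_mono mult_right_mono) auto
    moreover have "0 < c * s + a * (1 - s)"
      using pos s0 s1 by (intro add_nonneg_pos) auto
    ultimately show ?thesis using False g by (simp add: D_set_def)
  qed
qed

end

theory Submission
  imports Defs
begin

text \<open>
  Fix the \<open>k\<close> whose interval contains \<open>\<epsilon> = \<epsilon>\<^bsub>X|Y\<^esub>\<close>, and let \<open>\<ell>\<close> be the affine function which extends that
  piece of \<open>g\<^sub>\<alpha>\<close>, as a function of \<open>m = 1 - t\<close>. Let \<open>\<alpha> < 1\<close>; for \<open>\<alpha> > 1\<close> all inequalities are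
  reversed, and both cases are treated at once by a factor \<open>sgn (1 - \<alpha>)\<close>, which makes \<open>x\<^sup>\<alpha>\<close> concave.
  Every probability vector \<open>p\<close> with entries at most \<open>m\<close> satisfies \<open>\<parallel>p\<parallel>\<^sub>\<alpha> \<ge> \<ell> m\<close>. Indeed, for
  \<open>1/(k+1) \<le> m \<le> 1/k\<close> the norm is minimized by \<open>(m, \<dots>, m, 1 - k m)\<close>, where the reverse
  Minkowski inequality applies; for other \<open>m\<close> the cruder bound \<open>\<parallel>p\<parallel>\<^sub>\<alpha> \<ge> m powr (1 - 1/\<alpha>)\<close> suffices,
  because \<open>\<ell>\<close> is a chord of this convex function between \<open>1/(k+1)\<close> and \<open>1/k\<close>. Applying this to
  the conditional distribution of \<open>X\<close> given \<open>Y\<close> with maximal entry \<open>m(Y)\<close> and taking expectations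
  yields \<open>\<ell> (E m(Y))\<close>, as \<open>\<ell>\<close> is affine, and the maximum a posteriori estimator shows
  \<open>E m(Y) \<le> 1 - \<epsilon>\<close>. Using a single affine function replaces Jensen's inequality.
\<close>

section \<open>Extremal sums of concave functions\<close>

text \<open>\<open>x\<close> and \<open>y\<close> are convex combinations of \<open>c\<close> and
  \<open>d\<close> with mirrored weights \<open>t\<close> and \<open>1 - t\<close>, so the two
  concavity inequalities add up to the claim. In use, a pair of entries is spread apart at constant
  sum.\<close>

lemma concave_on_exchange:
  fixes f :: "real \<Rightarrow> real"
  assumes f: "concave_on S f" and S: "c \<in> S" "d \<in> S"
    and x: "c \<le> x" "x \<le> d" and y: "x + y = c + d"
  shows "f c + f d \<le> f x + f y"
proof (cases "c = d")
  case False
  define t where "t = (x - c) / (d - c)"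
  have cd: "d - c > 0" using False x by simp
  have t: "0 \<le> t" "t \<le> 1" using x cd by (auto simp: t_def)
  have "t * (d - c) = x - c" using cd by (simp add: t_def)
  then have xe: "(1 - t) * c + t * d = x" and ye: "(1 - (1 - t)) * c + (1 - t) * d = y"
    using y by (auto simp: algebra_simps)
  have "(1 - t) * f c + t * f d \<le> f x"
    using concave_onD[OF f t S] xe by simp
  moreover have "(1 - (1 - t)) * f c + (1 - t) * f d \<le> f y"
    using concave_onD[OF f _ _ S, of "1 - t"] t ye by simp
  ultimately show ?thesis by (simp add: algebra_simps)
qed (use x y in auto)

text \<open>
  The right-hand side below is attained by the most unevenly distributed values, namely \<open>k\<close> times
  \<open>m\<close> and a single remainder: any other vector bounded by \<open>m\<close> with the same sum is majorized by it.
\<close>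

lemma concave_sum_ge_extremal:
  fixes f :: "real \<Rightarrow> real" and k :: nat
  assumes f: "concave_on {0..} f" "f 0 = 0" and "finite F"
    and "\<And>x. x \<in> F \<Longrightarrow> 0 \<le> p x \<and> p x \<le> m" and "0 \<le> m"
    and "real k * m \<le> sum p F" "sum p F \<le> (real k + 1) * m"
  shows "real k * f m + f (sum p F - real k * m) \<le> (\<Sum>x\<in>F. f (p x))"
  using assms(3-)
proof (induction F arbitrary: k rule: finite_induct)
  case empty
  then have "real k * m \<le> 0" "0 \<le> real k * m" by auto
  \<comment> \<open>Either factor being zero makes \<open>real k * f m\<close> vanish, because
    \<open>f 0 = 0\<close>.\<close>
  then have "real k * m = 0" by (rule antisym)
  then show ?case using f by auto
next
  case (insert x F)
  define s where "s = sum p F"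
  have px: "0 \<le> p x" "p x \<le> m" using insert.prems(1) by auto
  have sums: "sum p (insert x F) = s + p x"
    "(\<Sum>y\<in>insert x F. f (p y)) = (\<Sum>y\<in>F. f (p y)) + f (p x)"
    using insert.hyps by (auto simp: s_def)
  note IH = insert.IH[folded s_def]
  show ?case
  proof (cases "real k * m \<le> s")
    case True
    have "s \<le> (real k + 1) * m" using insert.prems(4) sums(1) px by linarith
    then have "real k * f m + f (s - real k * m) \<le> (\<Sum>y\<in>F. f (p y))"
      using insert.prems(1,2) True by (intro IH) blast+
    \<comment> \<open>\<open>F\<close> already fills \<open>k\<close> entries \<open>m\<close>: the
      remainder absorbs the new entry, that is, the pair is spread to \<open>0\<close> and its
      sum.\<close>
    moreover have "f 0 + f (s - real k * m + p x) \<le> f (s - real k * m) + f (p x)"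
      using True px by (intro concave_on_exchange[OF f(1)]) auto
    ultimately show ?thesis unfolding sums f(2) by (simp add: algebra_simps)
  next
    case False
    have "s \<ge> 0" unfolding s_def using insert.prems by (intro sum_nonneg) auto
    then have "k \<noteq> 0" using False by (cases k) auto
    then obtain j where j: "k = Suc j" using not0_implies_Suc by blast
    have lo: "real j * m \<le> s" using insert.prems(3) sums(1) px unfolding j
      by (simp add: algebra_simps)
    have hi: "s \<le> (real j + 1) * m" using False unfolding j by (simp add: algebra_simps)
    have "real j * f m + f (s - real j * m) \<le> (\<Sum>y\<in>F. f (p y))"
      using insert.prems(1,2) lo hi by (intro IH) blast+
    \<comment> \<open>\<open>F\<close> fills only \<open>j = k - 1\<close> entries \<open>m\<close>:
      the old remainder and \<open>p x\<close> are spread until one of them equals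
      \<open>m\<close>.\<close>
    moreover have "f (s + p x - real k * m) + f m \<le> f (s - real j * m) + f (p x)"
      using insert.prems(3) sums(1) px lo hi unfolding j
      by (intro concave_on_exchange[OF f(1)]) (auto simp: algebra_simps)
    ultimately show ?thesis unfolding sums j by (simp add: algebra_simps)
  qed
qed

text \<open>The mass missing from a finite \<open>F\<close> is appended as one more entry, with
  index \<open>None\<close>, so that the total is exactly \<open>1\<close> and the finite bound
  applies. In the limit this entry tends to \<open>0\<close> and disappears by continuity.\<close>

lemma concave_has_sum_ge_extremal:
  fixes f :: "real \<Rightarrow> real" and k :: nat
  assumes f: "concave_on {0..} f" "f 0 = 0" "continuous_on {0..} f"
    and p: "(p has_sum 1) A" "\<And>x. x \<in> A \<Longrightarrow> 0 \<le> p x \<and> p x \<le> m"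
    and T: "((\<lambda>x. f (p x)) has_sum T) A"
    and m: "0 < m" "real k * m \<le> 1" "1 \<le> (real k + 1) * m"
  shows "real k * f m + f (1 - real k * m) \<le> T"
proof -
  let ?F = "finite_subsets_at_top A"
  have lim: "((\<lambda>F. sum p F) \<longlongrightarrow> 1) ?F" using p(1) by (simp add: has_sum_def)
  have le1: "sum p F \<le> 1" if "finite F" "F \<subseteq> A" for F
    using finite_sum_le_has_sum[OF p(1) that(1,2)] p(2) by auto
  have ev: "eventually (\<lambda>F. finite F \<and> F \<subseteq> A) ?F"
    by (simp add: eventually_finite_subsets_at_top_weakI)
  have "((\<lambda>F. 1 - sum p F) \<longlongrightarrow> 1 - 1) ?F" by (intro tendsto_intros lim)
  then have rest: "((\<lambda>F. 1 - sum p F) \<longlongrightarrow> 0) ?F" by simp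
  have "((\<lambda>F. f (1 - sum p F)) \<longlongrightarrow> f 0) ?F"
    by (rule continuous_on_tendsto_compose[OF f(3) rest])
      (use eventually_mono[OF ev] le1 in auto)
  then have "((\<lambda>F. (\<Sum>x\<in>F. f (p x)) + f (1 - sum p F)) \<longlongrightarrow> T + 0) ?F"
    using T f(2) by (intro tendsto_add) (auto simp: has_sum_def)
  \<comment> \<open>For large \<open>F\<close> the missing mass is below \<open>m\<close>, as the
    finite bound requires of every entry.\<close>
  moreover have "eventually (\<lambda>F. real k * f m + f (1 - real k * m)
      \<le> (\<Sum>x\<in>F. f (p x)) + f (1 - sum p F)) ?F"
    using ev order_tendstoD(2)[OF rest m(1)]
  proof eventually_elim
    case (elim F)
    define q where "q = case_option (1 - sum p F) p"
    have [simp]: "q None = 1 - sum p F" "q (Some x) = p x" for x by (auto simp: q_def)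
    let ?G = "insert None (Some ` F)"
    have S: "sum q ?G = 1" "(\<Sum>x\<in>?G. f (q x)) = f (1 - sum p F) + (\<Sum>x\<in>F. f (p x))"
      using elim by (auto simp: sum.reindex)
    have "real k * f m + f (sum q ?G - real k * m) \<le> (\<Sum>x\<in>?G. f (q x))"
      using elim m p(2) le1[of F] S(1) by (intro concave_sum_ge_extremal f(1,2)) auto
    then show ?case using S by simp
  qed
  ultimately show ?thesis
    by (intro tendsto_lowerbound[of _ "T"]) auto
qed

text \<open>The zero \<open>z\<close> nearer to \<open>m\<close> lies between \<open>m\<close> and
  the other zero \<open>w\<close>, so convexity at \<open>z\<close> reads
  \<open>0 \<le> (1 - t) * h m\<close> with \<open>t < 1\<close>.\<close>

lemma convex_on_nonneg_outside:
  fixes h :: "real \<Rightarrow> real"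
  assumes h: "convex_on S h" and S: "m \<in> S" "u \<in> S" "v \<in> S"
    and zero: "h u = 0" "h v = 0" and uv: "u < v" and m: "m \<le> u \<or> v \<le> m"
  shows "0 \<le> h m"
proof -
  have *: "0 \<le> h m" if w: "w \<in> S" "h w = 0" "h z = 0" and t: "0 \<le> t" "t < 1" "t * (w - m) = z - m" for w z t
  proof -
    have "(1 - t) * m + t * w = z" using t(3) by (simp add: algebra_simps)
    then have "h z \<le> (1 - t) * h m + t * h w"
      using convex_onD[OF h t(1) _ S(1) w(1)] t by simp
    then have "0 \<le> (1 - t) * h m" using w by simp
    then show ?thesis using t by (simp add: zero_le_mult_iff)
  qed
  from m show ?thesis
  proof
    assume "m \<le> u"
    then show ?thesis
      using uv S zero by (intro *[of v u "(u - m) / (v - m)"]) auto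
  next
    assume "v \<le> m"
    then show ?thesis
      using uv S zero
      by (intro *[of u v "(m - v) / (m - u)"]) (auto simp: field_simps)
  qed
qed

section \<open>The norm of a probability vector with bounded entries\<close>

lemma powr_superlinear_sgn:
  fixes t \<alpha> :: real
  assumes "0 \<le> t" "t \<le> 1" "0 < \<alpha>"
  shows "sgn (1 - \<alpha>) * t \<le> sgn (1 - \<alpha>) * t powr \<alpha>"
proof (cases "t = 0")
  case False
  then have "t > 0" using assms by simp
  then show ?thesis
    using powr_mono'[of 1 \<alpha> t] powr_mono'[of \<alpha> 1 t] assms by (auto simp: sgn_if)
qed auto

text \<open>The second derivative decides on the open half-line. Segments starting at
  \<open>0\<close>, where derivatives can be singular, reduce by homogeneity to comparing
  \<open>t powr \<alpha>\<close> with \<open>t\<close>.\<close>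

lemma concave_on_sgn_powr:
  fixes \<alpha> :: real
  assumes \<alpha>: "0 < \<alpha>"
  shows "concave_on {0..} (\<lambda>x. sgn (1 - \<alpha>) * x powr \<alpha>)"
proof (rule concave_on_linorderI)
  fix t x y :: real
  assume t: "0 < t" "t < 1" and xy: "x \<in> {0..}" "y \<in> {0..}" "x < y"
  show "(1 - t) * (sgn (1 - \<alpha>) * x powr \<alpha>) + t * (sgn (1 - \<alpha>) * y powr \<alpha>)
     \<le> sgn (1 - \<alpha>) * ((1 - t) *\<^sub>R x + t *\<^sub>R y) powr \<alpha>"
  proof (cases "x = 0")
    case True
    have "sgn (1 - \<alpha>) * t * y powr \<alpha> \<le> sgn (1 - \<alpha>) * t powr \<alpha> * y powr \<alpha>"
      using powr_superlinear_sgn[of t \<alpha>] t \<alpha> by (intro mult_right_mono) auto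
    then show ?thesis using True t xy \<alpha> by (simp add: powr_mult mult_ac)
  next
    case False
    have "concave_on {0<..} (\<lambda>x. sgn (1 - \<alpha>) * x powr \<alpha>)"
    proof (rule f''_le0_imp_concave)
      show "((\<lambda>x. sgn (1 - \<alpha>) * x powr \<alpha>) has_real_derivative
               sgn (1 - \<alpha>) * (\<alpha> * x powr (\<alpha> - 1))) (at x)" if "x \<in> {0<..}" for x
        using that by (auto intro!: derivative_eq_intros)
      show "((\<lambda>x. sgn (1 - \<alpha>) * (\<alpha> * x powr (\<alpha> - 1))) has_real_derivative
               sgn (1 - \<alpha>) * (\<alpha> * ((\<alpha> - 1) * x powr (\<alpha> - 2)))) (at x)" if "x \<in> {0<..}" for x
        using that by (auto intro!: derivative_eq_intros)
      show "sgn (1 - \<alpha>) * (\<alpha> * ((\<alpha> - 1) * x powr (\<alpha> - 2))) \<le> 0" for x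
        using \<alpha> by (auto simp: sgn_if mult_le_0_iff)
    qed auto
    then show ?thesis using False t xy by (intro concave_onD[of "{0<..}", simplified]) auto
  qed
qed auto

text \<open>
  As a function of the maximal probability \<open>m = 1 - t\<close>, this is the affine function which agrees
  with \<^term>\<open>g_fun \<alpha> t\<close> on the \<open>k\<close>-th interval.
\<close>

definition g_line :: "real \<Rightarrow> nat \<Rightarrow> real \<Rightarrow> real" where
  "g_line \<alpha> k m = (1 - real k * m) * (real k + 1) powr (1 / \<alpha>)
     + ((real k + 1) * m - 1) * real k powr (1 / \<alpha>)"

lemma g_fun_eq_g_line:
  assumes "k > 0" "t \<in> {1 - 1 / real k ..< 1 - 1 / (real k + 1)}"
  shows "g_fun \<alpha> t = g_line \<alpha> k (1 - t)"
  using assms(1) unfolding g_fun_eq[OF assms] g_line_def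
  by (simp add: powr_add algebra_simps)

text \<open>The slope in \<open>m\<close> is \<open>real k * (real k + 1) * (a - c)\<close>, and
  \<open>x powr (1 / \<alpha> - 1)\<close> increases in \<open>x\<close> for \<alpha> < 1 and
  decreases for \<alpha> > 1. This serves to replace the expected maximal probability by its upper
  bound \<open>1 - \<epsilon>\<close>.\<close>

lemma g_line_antimono:
  assumes \<alpha>: "0 < \<alpha>" and k: "0 < k" and m: "m \<le> m'"
  shows "sgn (1 - \<alpha>) * g_line \<alpha> k m' \<le> sgn (1 - \<alpha>) * g_line \<alpha> k m"
proof -
  define a where "a = real k powr (1 / \<alpha> - 1)"
  define c where "c = (real k + 1) powr (1 / \<alpha> - 1)"
  have pw: "real k powr (1 / \<alpha>) = real k * a" "(real k + 1) powr (1 / \<alpha>) = (real k + 1) * c"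
    using k by (simp_all add: a_def c_def powr_diff)
  have "0 \<le> sgn (1 - \<alpha>) * (c - a)"
  proof (cases \<alpha> "1 :: real" rule: linorder_cases)
    case less
    then have "a \<le> c" unfolding a_def c_def using \<alpha> by (intro powr_mono2) auto
    then show ?thesis using less by simp
  next
    case greater
    then have "c \<le> a" unfolding a_def c_def using k by (intro powr_mono2') auto
    then show ?thesis using greater by simp
  qed simp
  then have "0 \<le> sgn (1 - \<alpha>) * (c - a) * (real k * (real k + 1) * (m' - m))"
    by (rule mult_nonneg_nonneg) (use m in simp)
  then show ?thesis unfolding g_line_def pw by (simp add: algebra_simps)
qed

text \<open>The signed difference \<open>h\<close> of the power and its chord vanishes at
  \<open>1 / (k + 1)\<close> and \<open>1 / k\<close>. It is convex because
  \<open>(1 - 1 / \<alpha>) * (- 1 / \<alpha>)\<close> has the sign of \<open>1 - \<alpha>\<close>,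
  hence nonnegative beyond these points.\<close>

lemma g_line_le_powr_outside:
  fixes k :: nat
  assumes \<alpha>: "0 < \<alpha>" and k: "0 < k" and m: "0 < m" "m \<le> 1 / (real k + 1) \<or> 1 / real k \<le> m"
  shows "sgn (1 - \<alpha>) * g_line \<alpha> k m \<le> sgn (1 - \<alpha>) * m powr (1 - 1 / \<alpha>)"
proof -
  define h where "h = (\<lambda>m. sgn (1 - \<alpha>) * (m powr (1 - 1 / \<alpha>) - g_line \<alpha> k m))"
  let ?e = "1 - 1 / \<alpha>"
  have "convex_on {0<..} h"
  proof (rule f''_ge0_imp_convex)
    show "(h has_real_derivative sgn (1 - \<alpha>) * (?e * x powr (?e - 1)
        - ((real k + 1) * real k powr (1 / \<alpha>) - real k * (real k + 1) powr (1 / \<alpha>)))) (at x)"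
      if "x \<in> {0<..}" for x
      using that unfolding h_def g_line_def by (auto intro!: derivative_eq_intros)
    show "((\<lambda>x. sgn (1 - \<alpha>) * (?e * x powr (?e - 1)
        - ((real k + 1) * real k powr (1 / \<alpha>) - real k * (real k + 1) powr (1 / \<alpha>))))
        has_real_derivative (sgn (1 - \<alpha>) * (?e * ((?e - 1) * x powr (?e - 1 - 1))))) (at x)"
      if "x \<in> {0<..}" for x
      using that by (auto intro!: derivative_eq_intros)
    have "sgn (1 - \<alpha>) * (?e * (?e - 1)) = (sgn (1 - \<alpha>) * (1 - \<alpha>)) / \<alpha>\<^sup>2"
      using \<alpha> by (simp add: field_simps power2_eq_square)
    also have "\<dots> \<ge> 0" by (simp add: sgn_if)
    finally have "0 \<le> sgn (1 - \<alpha>) * (?e * (?e - 1)) * x powr (?e - 1 - 1)" for x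
      by (rule mult_nonneg_nonneg) simp
    then show "0 \<le> sgn (1 - \<alpha>) * (?e * ((?e - 1) * x powr (?e - 1 - 1)))" for x
      by (simp only: mult.assoc)
  qed auto
  moreover have "1 - real k * (1 / (real k + 1)) = 1 / (real k + 1)"
    "(real k + 1) * (1 / real k) - 1 = 1 / real k"
    using k by (simp_all add: field_simps)
  then have "h (1 / (real k + 1)) = 0" "h (1 / real k) = 0"
    using k unfolding h_def g_line_def by (simp_all add: powr_diff powr_divide)
  ultimately have "0 \<le> h m"
    using k m by (intro convex_on_nonneg_outside[of "{0<..}" h m "1 / (real k + 1)" "1 / real k"])
      (auto simp: field_simps)
  then show ?thesis by (simp add: h_def algebra_simps)
qed

text \<open>The two weights are nonnegative and add up to \<open>m > 0\<close>. Positivity permits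
  normalizing by this value and extracting roots.\<close>

lemma g_line_pos_inside:
  fixes k :: nat
  assumes "0 < k" "1 / (real k + 1) \<le> m" "m \<le> 1 / real k"
  shows "0 < g_line \<alpha> k m"
proof -
  have le: "0 \<le> 1 - real k * m" "0 \<le> (real k + 1) * m - 1" using assms by (auto simp: field_simps)
  have "0 < 1 / (real k + 1)" by simp
  then have "m > 0" using assms by linarith
  show ?thesis
  proof (cases "1 - real k * m = 0")
    case True
    then have "(real k + 1) * m - 1 = m" by (simp add: algebra_simps)
    then show ?thesis using True assms \<open>m > 0\<close> by (simp add: g_line_def)
  next
    case False
    then show ?thesis using le assms unfolding g_line_def
      by (intro add_pos_nonneg mult_pos_pos mult_nonneg_nonneg) auto
  qed
qed

text \<open>
  With \<open>a = 1 - k m\<close> and \<open>b = (k + 1) m - 1\<close>, the vector \<open>(m, \<dots>, m, 1 - k m)\<close> is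
  \<open>a (1, \<dots>, 1) + b (1, \<dots>, 1, 0)\<close>, so that the inequality is Minkowski's (reversed if \<open>\<alpha> < 1\<close>).
\<close>

lemma g_line_powr_le_inside:
  fixes k :: nat
  assumes \<alpha>: "0 < \<alpha>" and k: "0 < k" and m: "1 / (real k + 1) \<le> m" "m \<le> 1 / real k"
  shows "sgn (1 - \<alpha>) * g_line \<alpha> k m powr \<alpha> \<le>
     sgn (1 - \<alpha>) * (real k * m powr \<alpha> + (1 - real k * m) powr \<alpha>)"
proof -
  define n where "n = g_line \<alpha> k m"
  have n: "n > 0" unfolding n_def by (rule g_line_pos_inside) fact+
  \<comment> \<open>\<open>u\<close> and \<open>v\<close> are the entries that give the constant
    vectors of length \<open>k + 1\<close> and \<open>k\<close> unit \<alpha>-norm.\<close>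
  define u where "u = (real k + 1) powr (-1 / \<alpha>)"
  define v where "v = real k powr (-1 / \<alpha>)"
  \<comment> \<open>The share of the second vector in \<open>n\<close>: dividing
    \<open>(m, ..., m, 1 - k m)\<close> by \<open>n\<close> gives the convex combination of
    \<open>(u, ..., u)\<close> and \<open>(v, ..., v, 0)\<close> with weights \<open>1 - t\<close>
    and \<open>t\<close>.\<close>
  define t where "t = ((real k + 1) * m - 1) * real k powr (1 / \<alpha>) / n"
  have ge: "0 \<le> 1 - real k * m" "0 \<le> (real k + 1) * m - 1" using m k by (auto simp: field_simps)
  have uv: "u > 0" "v > 0" using k by (auto simp: u_def v_def)
  have "u powr \<alpha> = (real k + 1) powr - 1" "v powr \<alpha> = real k powr - 1"
    unfolding u_def v_def powr_powr using \<alpha> by simp_all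
  then have uv_powr: "(real k + 1) * u powr \<alpha> = 1" "real k * v powr \<alpha> = 1"
    using k by (simp_all add: powr_minus_divide)
  have t': "1 - t = (1 - real k * m) * (real k + 1) powr (1 / \<alpha>) / n"
    using n unfolding t_def by (simp add: n_def g_line_def field_simps)
  have t: "0 \<le> t" "0 \<le> 1 - t" using n ge unfolding t' by (auto simp: t_def)
  have tu: "(1 - t) * u = (1 - real k * m) / n"
    unfolding t' u_def using powr_add[of "real k + 1" "1 / \<alpha>" "- 1 / \<alpha>"] by simp
  have tv: "t * v = ((real k + 1) * m - 1) / n"
    unfolding t_def v_def using powr_add[of "real k" "1 / \<alpha>" "- 1 / \<alpha>"] k by simp
  have sum: "(1 - t) * u + t * v = m / n"
    unfolding tu tv by (simp add: add_divide_distrib[symmetric] algebra_simps)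
  let ?f = "\<lambda>x. sgn (1 - \<alpha>) * x powr \<alpha>"
  note c = concave_onD[OF concave_on_sgn_powr[OF \<alpha>], of t]
  \<comment> \<open>Concavity is applied in each coordinate: the first \<open>k\<close> share one
    inequality, and the last, where the second vector is \<open>0\<close>, has its own.\<close>
  have 1: "(1 - t) * ?f u + t * ?f v \<le> ?f (m / n)"
    using c[of u v] t uv sum by simp
  have 2: "(1 - t) * ?f u + t * ?f 0 \<le> ?f ((1 - real k * m) / n)"
    using c[of u 0] t uv tu by simp
  have "sgn (1 - \<alpha>) = real k * ((1 - t) * ?f u + t * ?f v) + ((1 - t) * ?f u + t * ?f 0)"
  proof -
    have "real k * ((1 - t) * ?f u + t * ?f v) + ((1 - t) * ?f u + t * ?f 0)
        = sgn (1 - \<alpha>) * ((1 - t) * ((real k + 1) * u powr \<alpha>) + t * (real k * v powr \<alpha>))"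
      by (simp add: algebra_simps)
    then show ?thesis unfolding uv_powr by simp
  qed
  also have "\<dots> \<le> real k * ?f (m / n) + ?f ((1 - real k * m) / n)"
    using 1 2 by (intro add_mono mult_left_mono) auto
  finally have "sgn (1 - \<alpha>) * n powr \<alpha>
      \<le> (real k * ?f (m / n) + ?f ((1 - real k * m) / n)) * n powr \<alpha>"
    by (intro mult_right_mono) auto
  also have "\<dots> = sgn (1 - \<alpha>) * (real k * m powr \<alpha> + (1 - real k * m) powr \<alpha>)"
  proof -
    have "m > 0" using m(1) by (rule less_le_trans[rotated]) simp
    then show ?thesis using n ge by (simp add: powr_divide field_simps)
  qed
  finally show ?thesis unfolding n_def .
qed

lemma g_line_le_norm:
  fixes p :: "'x \<Rightarrow> real" and k :: nat
  assumes \<alpha>: "0 < \<alpha>" and k: "0 < k"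
    and p: "(p has_sum 1) A" "\<And>x. x \<in> A \<Longrightarrow> 0 \<le> p x \<and> p x \<le> m"
    and T: "((\<lambda>x. p x powr \<alpha>) has_sum T) A"
  shows "sgn (1 - \<alpha>) * g_line \<alpha> k m \<le> sgn (1 - \<alpha>) * T powr (1 / \<alpha>)"
proof -
  have m: "m > 0"
  proof (rule ccontr)
    assume "\<not> m > 0"
    then have "p x = 0" if "x \<in> A" for x using p(2)[OF that] by linarith
    then have "(p has_sum 0) A" by (intro has_sum_0) auto
    then show False using p(1) has_sum_unique by fastforce
  qed
  have T0: "T \<ge> 0" using has_sum_nonneg[OF T] by simp
  have root: "sgn (1 - \<alpha>) * a \<le> sgn (1 - \<alpha>) * T powr (1 / \<alpha>)"
    if "sgn (1 - \<alpha>) * a powr \<alpha> \<le> sgn (1 - \<alpha>) * T" "a > 0" for a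
  proof -
    have "a = (a powr \<alpha>) powr (1 / \<alpha>)" using that \<alpha> by (simp add: powr_powr)
    then show ?thesis
      using that(1) T0 \<alpha> powr_mono2[of "1 / \<alpha>" "a powr \<alpha>" T] powr_mono2[of "1 / \<alpha>" T "a powr \<alpha>"]
      by (auto simp: sgn_if split: if_splits)
  qed
  have fT: "((\<lambda>x. sgn (1 - \<alpha>) * p x powr \<alpha>) has_sum (sgn (1 - \<alpha>) * T)) A"
    using T by (rule has_sum_cmult_right)
  show ?thesis
  proof (cases "1 / (real k + 1) \<le> m \<and> m \<le> 1 / real k")
    case True
    then have "sgn (1 - \<alpha>) * g_line \<alpha> k m powr \<alpha> \<le>
        real k * (sgn (1 - \<alpha>) * m powr \<alpha>) + sgn (1 - \<alpha>) * (1 - real k * m) powr \<alpha>"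
      using g_line_powr_le_inside[OF \<alpha> k, of m] by (simp add: algebra_simps)
    also have "\<dots> \<le> sgn (1 - \<alpha>) * T"
    proof (rule concave_has_sum_ge_extremal[OF concave_on_sgn_powr[OF \<alpha>] _ _ p fT m])
      show "continuous_on {0..} (\<lambda>x. sgn (1 - \<alpha>) * x powr \<alpha>)"
        using \<alpha> by (intro continuous_intros continuous_on_powr') auto
    qed (use True k in \<open>auto simp: field_simps\<close>)
    finally show ?thesis using g_line_pos_inside[OF k] True by (intro root) auto
  next
    case False
    \<comment> \<open>Here \<open>p x / m\<close> lies in \<open>[0, 1]\<close>, so its signed power
      dominates its signed value. Multiplying by \<open>m powr \<alpha>\<close> and summing
      \<open>p\<close> to \<open>1\<close> leaves \<open>m powr (\<alpha> - 1)\<close>.\<close>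
    have "(1 - 1 / \<alpha>) * \<alpha> = \<alpha> - 1" using \<alpha> by (simp add: field_simps)
    then have "sgn (1 - \<alpha>) * (m powr (1 - 1 / \<alpha>)) powr \<alpha> = m powr (\<alpha> - 1) * sgn (1 - \<alpha>) * 1"
      by (simp add: powr_powr)
    also have "\<dots> \<le> sgn (1 - \<alpha>) * T"
    proof (rule has_sum_mono[OF has_sum_cmult_right[OF p(1)] fT])
      fix x assume x: "x \<in> A"
      have "sgn (1 - \<alpha>) * (p x / m) * m powr \<alpha> \<le> sgn (1 - \<alpha>) * (p x / m) powr \<alpha> * m powr \<alpha>"
        using p(2)[OF x] m \<alpha> by (intro mult_right_mono powr_superlinear_sgn) auto
      then show "m powr (\<alpha> - 1) * sgn (1 - \<alpha>) * p x \<le> sgn (1 - \<alpha>) * p x powr \<alpha>"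
        using p(2)[OF x] m by (simp add: powr_divide powr_diff mult_ac)
    qed
    finally have "sgn (1 - \<alpha>) * m powr (1 - 1 / \<alpha>) \<le> sgn (1 - \<alpha>) * T powr (1 / \<alpha>)"
      using m by (intro root) auto
    with g_line_le_powr_outside[OF \<alpha> k m] False show ?thesis by force
  qed
qed

section \<open>Conditional probabilities and the maximum a posteriori estimator\<close>

lemma infsum_ennreal_eq:
  assumes "\<And>x. x \<in> A \<Longrightarrow> 0 \<le> f x" "f summable_on A"
  shows "(\<Sum>\<^sub>\<infinity>x\<in>A. ennreal (f x)) = ennreal (infsum f A)"
proof -
  have "(\<Sum>\<^sub>\<infinity>x\<in>A. ennreal (f x)) = (SUP F\<in>{F. finite F \<and> F \<subseteq> A}. \<Sum>x\<in>F. ennreal (f x))"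
    by (rule nonneg_infsum_complete) simp
  also have "\<dots> = (SUP F\<in>{F. finite F \<and> F \<subseteq> A}. ennreal (sum f F))"
    using assms(1) by (intro SUP_cong) (auto intro!: sum_ennreal)
  also have "\<dots> = ennreal (infsum f A)"
    using assms by (intro infsum_nonneg_is_SUPREMUM_ennreal[symmetric]) auto
  finally show ?thesis .
qed

lemma summable_on_if_infsum_ennreal_finite:
  assumes f: "\<And>x. x \<in> A \<Longrightarrow> 0 \<le> f x" and fin: "(\<Sum>\<^sub>\<infinity>x\<in>A. ennreal (f x)) \<noteq> \<infinity>"
  shows "f summable_on A"
proof (rule nonneg_bdd_above_summable_on[OF f], assumption, rule bdd_aboveI2)
  fix F assume F: "F \<in> {F. F \<subseteq> A \<and> finite F}"
  have "ennreal (sum f F) = (\<Sum>x\<in>F. ennreal (f x))" using F f by (auto intro!: sum_ennreal[symmetric])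
  also have "\<dots> = (\<Sum>\<^sub>\<infinity>x\<in>F. ennreal (f x))" using F by simp
  also have "\<dots> \<le> (\<Sum>\<^sub>\<infinity>x\<in>A. ennreal (f x))"
    using F by (intro infsum_mono_neutral) (auto intro: nonneg_summable_on_complete)
  finally show "sum f F \<le> enn2real (\<Sum>\<^sub>\<infinity>x\<in>A. ennreal (f x))"
    using fin enn2real_mono[of "ennreal (sum f F)"] F f
    by (simp add: less_top[symmetric] sum_nonneg subset_iff)
qed

lemma has_sum_of_nn_integral_count_space:
  assumes p: "\<And>x. x \<in> A \<Longrightarrow> 0 \<le> p x" and S: "(\<integral>\<^sup>+x. ennreal (p x) \<partial>count_space A) = 1"
  shows "(p has_sum 1) A"
proof -
  have "integrable (count_space A) p"
    using p S by (intro integrableI_nonneg) auto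
  then have abs: "Infinite_Set_Sum.abs_summable_on p A"
    by (simp add: Infinite_Set_Sum.abs_summable_on_def)
  have "infsetsum p A = 1" using infsetsum_conv_nn_integral[of A p] S p by simp
  moreover have "p summable_on A"
    using abs abs_summable_equivalent abs_summable_summable by blast
  ultimately show ?thesis using infsetsum_infsum[OF abs] has_sum_infsum by fastforce
qed

text \<open>Total mass \<open>1\<close> leaves room for at most \<open>1 / p y\<close> entries that
  reach a given positive \<open>p y\<close>; the maximum over this finite set is the global
  one.\<close>

lemma has_sum_1_attains_max:
  fixes p :: "'x \<Rightarrow> real"
  assumes p: "\<And>x. x \<in> A \<Longrightarrow> 0 \<le> p x" "(p has_sum 1) A"
  shows "\<exists>x\<in>A. \<forall>z\<in>A. p z \<le> p x"
proof -
  have "\<exists>y\<in>A. 0 < p y"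
  proof (rule ccontr)
    assume "\<not> ?thesis"
    then have "p x = 0" if "x \<in> A" for x using p(1)[OF that] that by force
    then have "(p has_sum 0) A" by (intro has_sum_0) auto
    then show False using p(2) has_sum_unique by fastforce
  qed
  then obtain y where y: "y \<in> A" "0 < p y" by blast
  define B where "B = {x \<in> A. p y \<le> p x}"
  have "finite B \<and> card B \<le> nat \<lceil>1 / p y\<rceil>"
  proof (rule finite_if_finite_subsets_card_bdd)
    fix G assume G: "G \<subseteq> B" "finite G"
    have "real (card G) * p y \<le> sum p G" using G by (intro sum_bounded_below) (auto simp: B_def)
    also have "\<dots> \<le> 1" using finite_sum_le_has_sum[OF p(2) G(2)] G p(1) by (auto simp: B_def)
    finally have "real (card G) \<le> 1 / p y" using y by (simp add: field_simps)
    then show "card G \<le> nat \<lceil>1 / p y\<rceil>" by linarith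
  qed
  then have fin: "finite (p ` B)" and ne: "p ` B \<noteq> {}" using y by (auto simp: B_def)
  then obtain x where x: "x \<in> B" "p x = Max (p ` B)" using Max_in[OF fin ne] by (metis imageE)
  have "p z \<le> p x" if "z \<in> A" for z
  proof (cases "z \<in> B")
    case True
    then show ?thesis using x fin by simp
  next
    case False
    then have "p z < p y" using that by (auto simp: B_def)
    then show ?thesis using x(1) by (auto simp: B_def)
  qed
  moreover have "x \<in> A" using x(1) by (simp add: B_def)
  ultimately show ?thesis by blast
qed

section \<open>Conditional probabilities form a probability vector\<close>

context finite_measure_subalgebra
begin

text \<open>The defining identity of conditional expectation, transferred to nonnegative integrals
  so that sums over the alphabet can be interchanged with them. Almost sure nonnegativity makes the
  conversion by \<open>ennreal\<close> lossless.\<close>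

lemma nn_integral_real_cond_exp_indicator:
  assumes B: "B \<in> sets M" and C: "C \<in> sets F"
  shows "(\<integral>\<^sup>+\<omega>. ennreal (real_cond_exp M F (indicator B) \<omega>) * indicator C \<omega> \<partial>M)
    = (\<integral>\<^sup>+\<omega>. indicator B \<omega> * indicator C \<omega> \<partial>M)"
proof -
  have CM: "C \<in> sets M" using C subalg by (auto simp: subalgebra_def)
  note [measurable] = B C CM
  let ?q = "real_cond_exp M F (indicator B)"
  have int: "integrable M (\<lambda>\<omega>. indicator C \<omega> * indicator B \<omega> :: real)"
    using B CM by (intro integrable_const_bound[of _ 1]) (auto split: split_indicator)
  have I: "integrable M (\<lambda>\<omega>. indicator C \<omega> * ?q \<omega>)"
    "(\<integral>\<omega>. indicator C \<omega> * ?q \<omega> \<partial>M) = (\<integral>\<omega>. indicator C \<omega> * indicator B \<omega> \<partial>M)"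
    by (rule real_cond_exp_intg[OF int]; measurable)+
  have pos: "AE \<omega> in M. ?q \<omega> \<ge> 0" by (rule real_cond_exp_pos) auto
  have "(\<integral>\<^sup>+\<omega>. ennreal (?q \<omega>) * indicator C \<omega> \<partial>M) = (\<integral>\<^sup>+\<omega>. ennreal (indicator C \<omega> * ?q \<omega>) \<partial>M)"
    by (intro nn_integral_cong) (auto split: split_indicator)
  also have "\<dots> = ennreal (\<integral>\<omega>. indicator C \<omega> * indicator B \<omega> \<partial>M)"
    unfolding I(2)[symmetric] using pos by (intro nn_integral_eq_integral I(1)) auto
  also have "\<dots> = (\<integral>\<^sup>+\<omega>. ennreal (indicator C \<omega> * indicator B \<omega>) \<partial>M)"
    by (intro nn_integral_eq_integral[symmetric] int) auto
  also have "\<dots> = (\<integral>\<^sup>+\<omega>. indicator B \<omega> * indicator C \<omega> \<partial>M)"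
    by (intro nn_integral_cong) (auto split: split_indicator)
  finally show ?thesis .
qed

text \<open>The sum \<open>S\<close> over the alphabet is \<open>F\<close>-measurable, and its
  integral over each \<open>C\<close> in \<open>F\<close> is the measure of \<open>C\<close>,
  because the events \<open>X = x\<close> partition the space. Thus \<open>S\<close> is a version of
  the conditional expectation of the constant \<open>1\<close>.\<close>

lemma AE_has_sum_real_cond_exp_vimage:
  assumes A: "countable A" and X: "X \<in> M \<rightarrow>\<^sub>M count_space A"
  shows "AE \<omega> in M. (\<forall>x\<in>A. 0 \<le> real_cond_exp M F (indicator (X -` {x} \<inter> space M)) \<omega>)
     \<and> ((\<lambda>x. real_cond_exp M F (indicator (X -` {x} \<inter> space M)) \<omega>) has_sum 1) A"
proof -
  define q where "q = (\<lambda>x. real_cond_exp M F (indicator (X -` {x} \<inter> space M)))"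
  have E: "X -` {x} \<inter> space M \<in> sets M" if "x \<in> A" for x
    using measurable_sets[OF X, of "{x}"] that by simp
  have qF: "q x \<in> borel_measurable F" for x unfolding q_def by (rule borel_measurable_cond_exp)
  have qM: "q x \<in> borel_measurable M" for x by (rule measurable_from_subalg[OF subalg qF])
  have "AE \<omega> in M. 0 \<le> q x \<omega>" if "x \<in> A" for x
    unfolding q_def using E[OF that] by (intro real_cond_exp_pos) auto
  then have pos: "AE \<omega> in M. \<forall>x\<in>A. 0 \<le> q x \<omega>" by (subst AE_ball_countable[OF A]) blast
  define S where "S = (\<lambda>\<omega>. \<integral>\<^sup>+x. ennreal (q x \<omega>) \<partial>count_space A)"
  have SF: "S \<in> borel_measurable F"
    unfolding S_def
  proof (rule sigma_finite_measure.borel_measurable_nn_integral)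
    show "sigma_finite_measure (count_space A)"
      by (rule sigma_finite_measure_count_space_countable[OF A])
    show "(\<lambda>(\<omega>, x). ennreal (q x \<omega>)) \<in> borel_measurable (F \<Otimes>\<^sub>M count_space A)"
      unfolding case_prod_beta
      by (rule measurable_compose_countable'[of A "\<lambda>i z. ennreal (q i (fst z))" _ _ snd])
        (use A qF in measurable)
  qed
  have int: "(\<integral>\<^sup>+\<omega>\<in>C. 1 \<partial>M) = (\<integral>\<^sup>+\<omega>\<in>C. S \<omega> \<partial>M)" if C: "C \<in> sets F" for C
  proof -
    have CM: "C \<in> sets M" using C subalg by (auto simp: subalgebra_def)
    have "(\<integral>\<^sup>+\<omega>\<in>C. S \<omega> \<partial>M) = (\<integral>\<^sup>+\<omega>. \<integral>\<^sup>+x. ennreal (q x \<omega>) * indicator C \<omega> \<partial>count_space A \<partial>M)"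
      unfolding S_def by (simp add: nn_integral_multc)
    also have "\<dots> = (\<integral>\<^sup>+x. \<integral>\<^sup>+\<omega>. ennreal (q x \<omega>) * indicator C \<omega> \<partial>M \<partial>count_space A)"
      using qM CM by (intro nn_integral_count_space_nn_integral A) (auto intro!: borel_measurable_times_ennreal borel_measurable_indicator)
    also have "\<dots> = (\<integral>\<^sup>+x. \<integral>\<^sup>+\<omega>. indicator (X -` {x} \<inter> space M) \<omega> * indicator C \<omega> \<partial>M \<partial>count_space A)"
      unfolding q_def by (intro nn_integral_cong nn_integral_real_cond_exp_indicator E C) simp
    also have "\<dots> = (\<integral>\<^sup>+\<omega>. \<integral>\<^sup>+x. indicator (X -` {x} \<inter> space M) \<omega> * indicator C \<omega> \<partial>count_space A \<partial>M)"
      using CM by (intro nn_integral_count_space_nn_integral[symmetric] A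
          borel_measurable_times_ennreal borel_measurable_indicator E)
    also have "\<dots> = (\<integral>\<^sup>+\<omega>\<in>C. 1 \<partial>M)"
    proof (rule nn_integral_cong)
      fix \<omega> assume w: "\<omega> \<in> space M"
      then have "X \<omega> \<in> A" using measurable_space[OF X] by simp
      have "(\<integral>\<^sup>+x. indicator (X -` {x} \<inter> space M) \<omega> * indicator C \<omega> \<partial>count_space A)
        = (\<integral>\<^sup>+x. indicator C \<omega> * indicator {X \<omega>} x \<partial>count_space A)"
        using w by (intro nn_integral_cong) (auto split: split_indicator)
      then show "(\<integral>\<^sup>+x. indicator (X -` {x} \<inter> space M) \<omega> * indicator C \<omega> \<partial>count_space A)
        = 1 * indicator C \<omega>"
        using \<open>X \<omega> \<in> A\<close> by (simp add: nn_integral_cmult_indicator)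
    qed
    finally show ?thesis ..
  qed
  have "AE \<omega> in M. S \<omega> = nn_cond_exp M F (\<lambda>_. 1) \<omega>"
    using int by (intro nn_cond_exp_charact SF) auto
  moreover have "AE \<omega> in M. 1 = nn_cond_exp M F (\<lambda>_. 1) \<omega>"
    by (rule nn_cond_exp_F_meas) auto
  ultimately have "AE \<omega> in M. (\<forall>x\<in>A. 0 \<le> q x \<omega>) \<and> ((\<lambda>x. q x \<omega>) has_sum 1) A"
    using pos by eventually_elim (auto simp: S_def intro!: has_sum_of_nn_integral_count_space)
  then show ?thesis unfolding q_def .
qed

end

lemma finite_measure_subalgebra_vimage_algebra:
  assumes "finite_measure M" "Y \<in> M \<rightarrow>\<^sub>M N"
  shows "finite_measure_subalgebra M (vimage_algebra (space M) Y N)"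
proof -
  interpret finite_measure M by fact
  show ?thesis
    by standard (use assms(2) measurable_space[OF assms(2)] in
      \<open>auto simp: subalgebra_def sets_vimage_algebra2 intro: measurable_sets\<close>)
qed

lemma AE_cond_pmf_has_sum:
  assumes "prob_space M" "countable A" "X \<in> M \<rightarrow>\<^sub>M count_space A" "Y \<in> M \<rightarrow>\<^sub>M N"
  shows "AE \<omega> in M. (\<forall>x\<in>A. 0 \<le> cond_pmf M N X Y x \<omega>)
     \<and> ((\<lambda>x. cond_pmf M N X Y x \<omega>) has_sum 1) A"
proof -
  interpret prob_space M by fact
  interpret finite_measure_subalgebra M "vimage_algebra (space M) Y N"
    using finite_measure_subalgebra_vimage_algebra assms(4) finite_measure_axioms by blast
  show ?thesis unfolding cond_pmf_def by (rule AE_has_sum_real_cond_exp_vimage) fact+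
qed

text \<open>The event that \<open>x\<close> is a most likely value is generated by \<open>Y\<close>,
  hence the preimage of some \<open>B x\<close>. The estimator returns the first \<open>x\<close> in
  an enumeration of \<open>A\<close> with \<open>y\<close> in \<open>B x\<close>; almost surely
  there is one, since a probability vector attains its maximum.\<close>

lemma MAP_estimator_exists:
  assumes M: "prob_space M" and A: "countable A" and X: "X \<in> M \<rightarrow>\<^sub>M count_space A"
    and Y: "Y \<in> M \<rightarrow>\<^sub>M N"
  obtains L where "L \<in> N \<rightarrow>\<^sub>M count_space A"
    "AE \<omega> in M. \<forall>x\<in>A. cond_pmf M N X Y x \<omega> \<le> cond_pmf M N X Y (L (Y \<omega>)) \<omega>"
proof -
  interpret prob_space M by fact
  define F where "F = vimage_algebra (space M) Y N"
  define q where "q = cond_pmf M N X Y"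
  have qF: "q x \<in> borel_measurable F" for x
    unfolding q_def cond_pmf_def F_def by (rule borel_measurable_cond_exp)
  have spF: "space F = space M" by (simp add: F_def)
  have "A \<noteq> {}" using measurable_space[OF X] not_empty by auto
  define e where "e = from_nat_into A"
  have e: "e n \<in> A" for n unfolding e_def using \<open>A \<noteq> {}\<close> by (rule from_nat_into)
  have e_surj: "\<exists>n. e n = x" if "x \<in> A" for x
    unfolding e_def using from_nat_into_surj[OF A that] .
  have "{\<omega> \<in> space F. \<forall>z\<in>A. q z \<omega> \<le> q x \<omega>} \<in> sets F" for x
    using qF A by measurable
  moreover have "sets F = {Y -` B \<inter> space M | B. B \<in> sets N}"
    unfolding F_def using measurable_space[OF Y] by (intro sets_vimage_algebra2) auto
  ultimately have "\<exists>B\<in>sets N. {\<omega> \<in> space M. \<forall>z\<in>A. q z \<omega> \<le> q x \<omega>} = Y -` B \<inter> space M" for x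
    using spF by (auto 0 0 simp: Bex_def conj_commute)
  then obtain B where B: "\<And>x. B x \<in> sets N"
    "\<And>x. {\<omega> \<in> space M. \<forall>z\<in>A. q z \<omega> \<le> q x \<omega>} = Y -` B x \<inter> space M"
    by metis
  \<comment> \<open>If no index qualifies, \<open>LEAST\<close> is an unspecified number, which
    \<open>e\<close> still maps into \<open>A\<close>; for \<open>y = Y \<omega>\<close> this occurs
    only on a null set.\<close>
  define L where "L = (\<lambda>y. e (LEAST n. y \<in> B (e n)))"
  have "(\<lambda>y. LEAST n. y \<in> B (e n)) \<in> N \<rightarrow>\<^sub>M count_space UNIV"
    using B(1) by measurable
  moreover have "e \<in> count_space UNIV \<rightarrow>\<^sub>M count_space A" using e by simp
  ultimately have L: "L \<in> N \<rightarrow>\<^sub>M count_space A"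
    unfolding L_def by (rule measurable_compose)
  have "AE \<omega> in M. \<forall>x\<in>A. q x \<omega> \<le> q (L (Y \<omega>)) \<omega>"
    using AE_cond_pmf_has_sum[OF assms] AE_space
  proof eventually_elim
    case (elim \<omega>)
    then obtain x where x: "x \<in> A" "\<forall>z\<in>A. q z \<omega> \<le> q x \<omega>"
      using has_sum_1_attains_max[of A "\<lambda>x. q x \<omega>"] unfolding q_def by blast
    obtain n where "e n = x" using e_surj x by blast
    then have "Y \<omega> \<in> B (e n)" using B(2)[of x] x elim by auto
    then have "Y \<omega> \<in> B (L (Y \<omega>))" unfolding L_def by (rule LeastI)
    then show ?case using B(2)[of "L (Y \<omega>)"] elim by auto
  qed
  then show ?thesis using that L unfolding q_def by blast
qed

section \<open>Success probability of an estimator\<close>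

lemma sets_Collect_eq_count_space:
  assumes A: "countable A" and X: "X \<in> M \<rightarrow>\<^sub>M count_space A" and Z: "Z \<in> M \<rightarrow>\<^sub>M count_space A"
  shows "{\<omega> \<in> space M. X \<omega> = Z \<omega>} \<in> sets M"
proof -
  have "(\<lambda>\<omega>. X \<omega> = z) \<in> M \<rightarrow>\<^sub>M count_space UNIV" for z
    by (rule measurable_compose[OF X]) simp
  then have "(\<lambda>\<omega>. X \<omega> = Z \<omega>) \<in> M \<rightarrow>\<^sub>M count_space UNIV"
    by (rule measurable_compose_countable'[OF _ Z A])
  then show ?thesis by measurable
qed

text \<open>The event \<open>C x\<close> that the estimate is \<open>x\<close> belongs to
  \<open>F\<close>, so integrating the conditional probability of \<open>x\<close> over it gives the
  probability that \<open>X\<close> and the estimate both equal \<open>x\<close>. Summation over the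
  alphabet finishes.\<close>

lemma prob_estimator_correct:
  assumes M: "prob_space M" and A: "countable A" and X: "X \<in> M \<rightarrow>\<^sub>M count_space A"
    and Y: "Y \<in> M \<rightarrow>\<^sub>M N" and L: "L \<in> N \<rightarrow>\<^sub>M count_space A"
  shows "integrable M (\<lambda>\<omega>. cond_pmf M N X Y (L (Y \<omega>)) \<omega>)"
    and "(\<integral>\<omega>. cond_pmf M N X Y (L (Y \<omega>)) \<omega> \<partial>M) = \<P>(\<omega> in M. X \<omega> = L (Y \<omega>))"
proof -
  interpret prob_space M by fact
  define F where "F = vimage_algebra (space M) Y N"
  interpret F: finite_measure_subalgebra M F
    unfolding F_def using finite_measure_subalgebra_vimage_algebra Y finite_measure_axioms by blast
  define q where "q = cond_pmf M N X Y"
  have qM: "q x \<in> borel_measurable M" for x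
    unfolding q_def cond_pmf_def by (rule borel_measurable_cond_exp2)
  have LY: "(\<lambda>\<omega>. L (Y \<omega>)) \<in> M \<rightarrow>\<^sub>M count_space A" using measurable_compose[OF Y L] .
  have YF: "Y \<in> F \<rightarrow>\<^sub>M N"
    unfolding F_def using measurable_space[OF Y] by (intro measurable_vimage_algebra1) auto
  have mM: "(\<lambda>\<omega>. q (L (Y \<omega>)) \<omega>) \<in> borel_measurable M"
    by (rule measurable_compose_countable'[OF qM LY A])
  have E: "X -` {x} \<inter> space M \<in> sets M" if "x \<in> A" for x
    using measurable_sets[OF X, of "{x}"] that by simp
  define C where "C = (\<lambda>x. (\<lambda>\<omega>. L (Y \<omega>)) -` {x} \<inter> space M)"
  have C: "C x \<in> sets F" if "x \<in> A" for x
    using measurable_sets[OF measurable_compose[OF YF L], of "{x}"] that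
    unfolding C_def by (simp add: F_def)
  have CM: "C x \<in> sets M" if "x \<in> A" for x
    using C[OF that] F.subalg by (auto simp: subalgebra_def)
  \<comment> \<open>Exactly one of the events \<open>C x\<close> with \<open>x\<close> in
    \<open>A\<close> occurs at each point.\<close>
  have single: "(\<integral>\<^sup>+x. f x * indicator (C x) \<omega> \<partial>count_space A) = f (L (Y \<omega>))"
    if "\<omega> \<in> space M" for f :: "'b \<Rightarrow> ennreal" and \<omega>
  proof -
    have "L (Y \<omega>) \<in> A" using measurable_space[OF LY that] by simp
    have "(\<integral>\<^sup>+x. f x * indicator (C x) \<omega> \<partial>count_space A)
      = (\<integral>\<^sup>+x. f x * indicator {L (Y \<omega>)} x \<partial>count_space A)"
      using that by (intro nn_integral_cong) (auto simp: C_def split: split_indicator)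
    then show ?thesis using \<open>L (Y \<omega>) \<in> A\<close> by (simp add: nn_integral_indicator_singleton)
  qed
  have "(\<integral>\<^sup>+\<omega>. ennreal (q (L (Y \<omega>)) \<omega>) \<partial>M)
      = (\<integral>\<^sup>+\<omega>. \<integral>\<^sup>+x. ennreal (q x \<omega>) * indicator (C x) \<omega> \<partial>count_space A \<partial>M)"
    by (intro nn_integral_cong single[symmetric])
  also have "\<dots> = (\<integral>\<^sup>+x. \<integral>\<^sup>+\<omega>. ennreal (q x \<omega>) * indicator (C x) \<omega> \<partial>M \<partial>count_space A)"
    using qM CM by (intro nn_integral_count_space_nn_integral A)
      (auto intro!: borel_measurable_times_ennreal borel_measurable_indicator)
  also have "\<dots> = (\<integral>\<^sup>+x. \<integral>\<^sup>+\<omega>. indicator (X -` {x} \<inter> space M) \<omega> * indicator (C x) \<omega> \<partial>M \<partial>count_space A)"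
    unfolding q_def cond_pmf_def F_def[symmetric]
    by (intro nn_integral_cong F.nn_integral_real_cond_exp_indicator E C) simp_all
  also have "\<dots> = (\<integral>\<^sup>+\<omega>. \<integral>\<^sup>+x. indicator (X -` {x} \<inter> space M) \<omega> * indicator (C x) \<omega> \<partial>count_space A \<partial>M)"
    by (intro nn_integral_count_space_nn_integral[symmetric] A
        borel_measurable_times_ennreal borel_measurable_indicator E CM)
  also have "\<dots> = (\<integral>\<^sup>+\<omega>. indicator {\<omega> \<in> space M. X \<omega> = L (Y \<omega>)} \<omega> \<partial>M)"
  proof (intro nn_integral_cong)
    fix \<omega> assume w: "\<omega> \<in> space M"
    show "(\<integral>\<^sup>+x. indicator (X -` {x} \<inter> space M) \<omega> * indicator (C x) \<omega> \<partial>count_space A)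
      = (indicator {\<omega> \<in> space M. X \<omega> = L (Y \<omega>)} \<omega> :: ennreal)"
      unfolding single[OF w] using w by (auto split: split_indicator)
  qed
  also have "\<dots> = emeasure M {\<omega> \<in> space M. X \<omega> = L (Y \<omega>)}"
    by (intro nn_integral_indicator sets_Collect_eq_count_space[OF A X LY])
  also have "\<dots> = ennreal \<P>(\<omega> in M. X \<omega> = L (Y \<omega>))" by (rule emeasure_eq_measure)
  finally have nn: "(\<integral>\<^sup>+\<omega>. ennreal (q (L (Y \<omega>)) \<omega>) \<partial>M) = ennreal \<P>(\<omega> in M. X \<omega> = L (Y \<omega>))" .
  have pos: "AE \<omega> in M. 0 \<le> q (L (Y \<omega>)) \<omega>"
    using AE_cond_pmf_has_sum[OF M A X Y] AE_space
    by eventually_elim (use measurable_space[OF LY] in \<open>auto simp: q_def\<close>)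
  show "integrable M (\<lambda>\<omega>. cond_pmf M N X Y (L (Y \<omega>)) \<omega>)"
    using integrableI_nonneg[OF mM pos] nn by (simp add: q_def)
  show "(\<integral>\<omega>. cond_pmf M N X Y (L (Y \<omega>)) \<omega> \<partial>M) = \<P>(\<omega> in M. X \<omega> = L (Y \<omega>))"
    using integral_eq_nn_integral[OF mM pos] nn by (simp add: q_def)
qed

lemma min_error_prob_le:
  assumes M: "prob_space M" and A: "countable A" and X: "X \<in> M \<rightarrow>\<^sub>M count_space A"
    and Y: "Y \<in> M \<rightarrow>\<^sub>M N" and L: "L \<in> N \<rightarrow>\<^sub>M count_space A"
  shows "min_error_prob M A N X Y \<le> 1 - \<P>(\<omega> in M. X \<omega> = L (Y \<omega>))"
proof -
  interpret prob_space M by fact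
  have "min_error_prob M A N X Y \<le> \<P>(\<omega> in M. X \<omega> \<noteq> L (Y \<omega>))"
    unfolding min_error_prob_def by (rule cINF_lower[OF _ L]) (auto intro!: bdd_belowI2[of _ 0])
  also have "\<dots> = 1 - \<P>(\<omega> in M. X \<omega> = L (Y \<omega>))"
    by (intro prob_neg sets_Collect_eq_count_space[OF A X] measurable_compose[OF Y L])
  finally show ?thesis .
qed

section \<open>The lower bound on the conditional entropy\<close>

lemma integral_g_line:
  assumes "prob_space M" "integrable M f"
  shows "integrable M (\<lambda>\<omega>. g_line \<alpha> k (f \<omega>))"
    and "(\<integral>\<omega>. g_line \<alpha> k (f \<omega>) \<partial>M) = g_line \<alpha> k (\<integral>\<omega>. f \<omega> \<partial>M)"
proof -
  interpret prob_space M by fact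
  show "integrable M (\<lambda>\<omega>. g_line \<alpha> k (f \<omega>))" using assms by (simp add: g_line_def)
  show "(\<integral>\<omega>. g_line \<alpha> k (f \<omega>) \<partial>M) = g_line \<alpha> k (\<integral>\<omega>. f \<omega> \<partial>M)"
    using assms by (simp add: g_line_def prob_space)
qed

text \<open>For \<alpha> < 1 the line can be negative at large \<open>m\<close>, as for
  \<open>k = 2\<close>, \<open>\<alpha> = 1 / 2\<close>, \<open>m = 1\<close>. There
  \<open>ennreal\<close> truncates to \<open>0\<close>, which only enlarges the right-hand
  side.\<close>

lemma ennreal_integral_le_nn_integral:
  assumes "integrable M f"
  shows "ennreal (\<integral>x. f x \<partial>M) \<le> (\<integral>\<^sup>+x. ennreal (f x) \<partial>M)"
proof -
  have max: "integrable M (\<lambda>x. max 0 (f x))" using assms by auto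
  have "ennreal (\<integral>x. f x \<partial>M) \<le> ennreal (\<integral>x. max 0 (f x) \<partial>M)"
    using assms max by (intro ennreal_leI integral_mono) auto
  also have "\<dots> = (\<integral>\<^sup>+x. ennreal (max 0 (f x)) \<partial>M)"
    using max by (intro nn_integral_eq_integral[symmetric]) auto
  also have "\<dots> = (\<integral>\<^sup>+x. ennreal (f x) \<partial>M)" by (simp add: ennreal_max_0)
  finally show ?thesis .
qed

lemma g_line_le_ennreal_norm:
  assumes \<alpha>: "0 < \<alpha>" "\<alpha> < 1" and k: "0 < k"
    and p: "(p has_sum 1) A" "\<And>x. x \<in> A \<Longrightarrow> 0 \<le> p x \<and> p x \<le> m"
  shows "ennreal (g_line \<alpha> k m) \<le> ennreal_powr (\<Sum>\<^sub>\<infinity>x\<in>A. ennreal (p x powr \<alpha>)) (1 / \<alpha>)"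
proof (cases "(\<Sum>\<^sub>\<infinity>x\<in>A. ennreal (p x powr \<alpha>)) = \<infinity>")
  case True
  then show ?thesis by (simp add: ennreal_powr_def)
next
  case False
  then have s: "(\<lambda>x. p x powr \<alpha>) summable_on A"
    by (intro summable_on_if_infsum_ennreal_finite) auto
  let ?T = "infsum (\<lambda>x. p x powr \<alpha>) A"
  have "?T \<ge> 0" by (intro infsum_nonneg) auto
  then show ?thesis
    using g_line_le_norm[OF \<alpha>(1) k p has_sum_infsum[OF s]] \<alpha> infsum_ennreal_eq[OF _ s]
    by (simp add: ennreal_powr_def ennreal_leI)
qed

text \<open>Entries are at most \<open>1\<close>, so \<open>p x powr \<alpha> \<le> p x\<close> and
  the sum converges. Nonnegativity of the line makes its integral in \<open>[0, \<infinity>]\<close>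
  the ordinary one.\<close>

lemma ennreal_norm_le_g_line:
  assumes \<alpha>: "1 < \<alpha>" and k: "0 < k"
    and p: "(p has_sum 1) A" "\<And>x. x \<in> A \<Longrightarrow> 0 \<le> p x \<and> p x \<le> m"
  shows "ennreal_powr (\<Sum>\<^sub>\<infinity>x\<in>A. ennreal (p x powr \<alpha>)) (1 / \<alpha>) \<le> ennreal (g_line \<alpha> k m)"
    and "0 \<le> g_line \<alpha> k m"
proof -
  have "p x \<le> 1" if "x \<in> A" for x
    using finite_sum_le_has_sum[OF p(1), of "{x}"] p(2) that by auto
  then have le_p: "p x powr \<alpha> \<le> p x" if "x \<in> A" for x
    using powr_superlinear_sgn[of "p x" \<alpha>] p(2) that \<alpha> by simp
  have s: "(\<lambda>x. p x powr \<alpha>) summable_on A"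
    by (rule summable_on_comparison_test[OF has_sum_imp_summable[OF p(1)]]) (use le_p in auto)
  let ?T = "infsum (\<lambda>x. p x powr \<alpha>) A"
  have T: "?T \<ge> 0" by (intro infsum_nonneg) auto
  have le: "?T powr (1 / \<alpha>) \<le> g_line \<alpha> k m"
    using g_line_le_norm[OF _ k p has_sum_infsum[OF s]] \<alpha> by simp
  then show "ennreal_powr (\<Sum>\<^sub>\<infinity>x\<in>A. ennreal (p x powr \<alpha>)) (1 / \<alpha>) \<le> ennreal (g_line \<alpha> k m)"
    using T infsum_ennreal_eq[OF _ s] by (simp add: ennreal_powr_def ennreal_leI)
  show "0 \<le> g_line \<alpha> k m" using le powr_ge_zero[of ?T "1 / \<alpha>"] by linarith
qed

lemma log_le_log_ennreal:
  assumes "1 < b" "0 < r" "ennreal r \<le> x"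
  shows "ereal (log b r) \<le> log_ennreal b x"
proof (cases x)
  case (real y)
  then have "r \<le> y" using assms by (simp add: ennreal_le_iff)
  then show ?thesis using real assms by (simp add: log_ennreal_def)
qed (simp add: log_ennreal_def)

lemma log_ennreal_le_log:
  assumes "1 < b" "0 < r" "x \<le> ennreal r"
  shows "log_ennreal b x \<le> ereal (log b r)"
proof (cases x)
  case (real y)
  then have "y \<le> r" using assms by (simp add: ennreal_le_iff)
  then show ?thesis using real assms by (auto simp: log_ennreal_def)
next
  case top
  then show ?thesis using assms by (simp add: top_unique)
qed

theorem theorem11:
  fixes M :: "'w measure" and N :: "'y measure" and A :: "'x set"
    and X :: "'w \<Rightarrow> 'x" and Y :: "'w \<Rightarrow> 'y" and b \<alpha> :: real
  assumes "prob_space M"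
    and "countable A" and "X \<in> M \<rightarrow>\<^sub>M count_space A"
    and "Y \<in> M \<rightarrow>\<^sub>M N"
    and "b > 1"
    and "\<alpha> \<in> {0<..<1} \<union> {1<..}"
  shows "ereal (\<alpha> / (1 - \<alpha>) * log b (g_fun \<alpha> (min_error_prob M A N X Y)))
           \<le> arimoto_renyi_entropy b \<alpha> M A N X Y"
proof -
  note basic = assms(1-4)
  have \<alpha>: "0 < \<alpha>" "\<alpha> \<noteq> 1" using assms(6) by auto
  define \<epsilon> where "\<epsilon> = min_error_prob M A N X Y"
  have \<epsilon>: "\<epsilon> \<in> {0..<1}" unfolding \<epsilon>_def by (rule min_error_prob_range[OF basic])
  obtain k where k: "k > 0" "\<epsilon> \<in> {1 - 1 / real k ..< 1 - 1 / (real k + 1)}"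
    using piece_exists[OF \<epsilon>] by blast
  have g: "g_fun \<alpha> \<epsilon> = g_line \<alpha> k (1 - \<epsilon>)" by (rule g_fun_eq_g_line[OF k])
  have g_pos: "0 < g_fun \<alpha> \<epsilon>"
    using funcset_mem[OF g_fun_range[OF \<alpha>] \<epsilon>] by (auto simp: D_set_def split: if_splits)
  obtain L where L: "L \<in> N \<rightarrow>\<^sub>M count_space A"
    "AE \<omega> in M. \<forall>x\<in>A. cond_pmf M N X Y x \<omega> \<le> cond_pmf M N X Y (L (Y \<omega>)) \<omega>"
    using MAP_estimator_exists[OF basic] .
  define m where "m = (\<lambda>\<omega>. cond_pmf M N X Y (L (Y \<omega>)) \<omega>)"
  have m: "integrable M m" "(\<integral>\<omega>. m \<omega> \<partial>M) \<le> 1 - \<epsilon>"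
    using prob_estimator_correct[OF basic L(1)] min_error_prob_le[OF basic L(1)]
    by (simp_all add: m_def \<epsilon>_def)
  have AE: "AE \<omega> in M. ((\<lambda>x. cond_pmf M N X Y x \<omega>) has_sum 1) A \<and>
      (\<forall>x\<in>A. 0 \<le> cond_pmf M N X Y x \<omega> \<and> cond_pmf M N X Y x \<omega> \<le> m \<omega>)"
    using AE_cond_pmf_has_sum[OF basic] L(2) by eventually_elim (auto simp: m_def)
  note G = integral_g_line[OF basic(1) m(1), of \<alpha> k]
  \<comment> \<open>\<open>g_fun \<alpha> \<epsilon>\<close> is the line at
    \<open>1 - \<epsilon>\<close>, and the mean of the line is the line at the mean of
    \<open>m\<close>.\<close>
  have le: "sgn (1 - \<alpha>) * g_fun \<alpha> \<epsilon> \<le> sgn (1 - \<alpha>) * (\<integral>\<omega>. g_line \<alpha> k (m \<omega>) \<partial>M)"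
    unfolding g G(2) by (rule g_line_antimono[OF \<alpha>(1) k(1) m(2)])
  define I where "I = (\<integral>\<^sup>+ \<omega>. ennreal_powr
    (\<Sum>\<^sub>\<infinity>x\<in>A. ennreal (cond_pmf M N X Y x \<omega> powr \<alpha>)) (1 / \<alpha>) \<partial>M)"
  \<comment> \<open>For \<alpha> > 1 the prefactor of the logarithm is negative and reverses the
    order; \<open>x\<close> may be \<open>-\<infinity>\<close>.\<close>
  have neg_mult: "ereal c * ereal r \<le> ereal c * x" if "c < 0" "x \<le> ereal r" for c r x
    using that by (cases x) (auto intro: mult_left_mono_neg)
  have "ereal (\<alpha> / (1 - \<alpha>)) * ereal (log b (g_fun \<alpha> \<epsilon>)) \<le> ereal (\<alpha> / (1 - \<alpha>)) * log_ennreal b I"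
  proof (cases "\<alpha> < 1")
    case True
    then have "ennreal (g_fun \<alpha> \<epsilon>) \<le> ennreal (\<integral>\<omega>. g_line \<alpha> k (m \<omega>) \<partial>M)"
      using le by (intro ennreal_leI) simp
    also have "\<dots> \<le> (\<integral>\<^sup>+\<omega>. ennreal (g_line \<alpha> k (m \<omega>)) \<partial>M)"
      by (rule ennreal_integral_le_nn_integral[OF G(1)])
    also have "\<dots> \<le> I"
      unfolding I_def
    proof (rule nn_integral_mono_AE)
      show "AE \<omega> in M. ennreal (g_line \<alpha> k (m \<omega>)) \<le>
          ennreal_powr (\<Sum>\<^sub>\<infinity>x\<in>A. ennreal (cond_pmf M N X Y x \<omega> powr \<alpha>)) (1 / \<alpha>)"
        using AE by eventually_elim (rule g_line_le_ennreal_norm[OF \<alpha>(1) True k(1)], auto)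
    qed
    finally show ?thesis
      using True \<alpha> assms(5) g_pos by (intro ereal_mult_left_mono log_le_log_ennreal) auto
  next
    case False
    then have \<alpha>1: "1 < \<alpha>" using \<alpha> by simp
    have "I \<le> (\<integral>\<^sup>+\<omega>. ennreal (g_line \<alpha> k (m \<omega>)) \<partial>M)"
      unfolding I_def
    proof (rule nn_integral_mono_AE)
      show "AE \<omega> in M. ennreal_powr (\<Sum>\<^sub>\<infinity>x\<in>A. ennreal (cond_pmf M N X Y x \<omega> powr \<alpha>)) (1 / \<alpha>)
          \<le> ennreal (g_line \<alpha> k (m \<omega>))"
        using AE by eventually_elim (rule ennreal_norm_le_g_line(1)[OF \<alpha>1 k(1)], auto)
    qed
    also have "\<dots> = ennreal (\<integral>\<omega>. g_line \<alpha> k (m \<omega>) \<partial>M)"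
    proof (rule nn_integral_eq_integral[OF G(1)])
      show "AE \<omega> in M. 0 \<le> g_line \<alpha> k (m \<omega>)"
        using AE
      proof eventually_elim
        case (elim \<omega>)
        then show ?case
          using ennreal_norm_le_g_line(2)[OF \<alpha>1 k(1), of "\<lambda>x. cond_pmf M N X Y x \<omega>" A "m \<omega>"] by simp
      qed
    qed
    also have "\<dots> \<le> ennreal (g_fun \<alpha> \<epsilon>)" using le \<alpha>1 by (intro ennreal_leI) simp
    finally have "log_ennreal b I \<le> ereal (log b (g_fun \<alpha> \<epsilon>))"
      using assms(5) g_pos by (intro log_ennreal_le_log)
    moreover have "\<alpha> / (1 - \<alpha>) < 0" using \<alpha>1 by (simp add: divide_pos_neg)
    ultimately show ?thesis by (rule neg_mult[rotated])
  qed
  then show ?thesis unfolding arimoto_renyi_entropy_def I_def \<epsilon>_def times_ereal.simps(1) .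
qed

end
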